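(* Let $\mathbb{F}_q$ be a finite field with $q\equiv 1\pmod{3}$, let $s=(q-1)/3$, let $\mu_3=\{u\in\mathbb{F}_q^*: u^3=1\}$, and let $K=\{z\in\mathbb{F}_q^*: z^s=1\}$. Let $r$ be a positive integer and let $c\colon\mu_3\to\mathbb{F}_q^*$ be a function. Define $f\colon\mathbb{F}_q\to\mathbb{F}_q$ by $f(0)=0$ and $f(x)=x^r\,c(x^s)$ for $x\in\mathbb{F}_q^*$ (note $x^s\in\mu_3$ for $x\in\mathbb{F}_q^*$), and let $F(x)=f(x)+x$. Assume: (G1) $\gcd(r,s)=1$, $\gcd(r,3)=1$, and $c(u)^s=1$ for all $u\in\mu_3$; (G2) for each $u\in\mu_3$ and each $t\in\mathbb{F}_q^*$ with $t^s=u$, setting $\beta_u:=c(u)\,t^{r-1}$, the map $\varphi_u\colon K\to\mathbb{F}_q^*$, $z\mapsto z\,(1+\beta_u z^{r-1})$, is injective; (G3) for each $u\in\mu_3$ (and $t$, $\beta_u$ as in (G2)), the value $(1+\beta_u z^{r-1})^s$ is independent of the choice of $z\in K$ and lies in $\mu_3$; denote it $v(u)$; (G4) the map $\bar\psi\colon\mu_3\to\mu_3$, $\bar\psi(u)=u\cdot v(u)$, is a permutation of $\mu_3$. Then $f$ is a complete permutation polynomial of $\mathbb{F}_q$, i.e., both $f$ and $F$ are bijections of $\mathbb{F}_q$.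
   Context: A complete permutation polynomial of $\mathbb{F}_q$ is a polynomial (equivalently, a function $\mathbb{F}_q\to\mathbb{F}_q$) $f$ such that both $x\mapsto f(x)$ and $x\mapsto f(x)+x$ are permutations of $\mathbb{F}_q$. The function $f$ above agrees on $\mathbb{F}_q$ with a polynomial of the form $X^r h(X^s)$, where $h$ is a polynomial interpolating $c$ on $\mu_3$. *)

theory Defs
  imports Complex_Main "HOL-Library.Cardinality" "HOL-Library.FuncSet" "HOL-Number_Theory.Cong"
begin

definition complete_permutation :: "('a::{field,finite} \<Rightarrow> 'a) \<Rightarrow> bool" where
  "complete_permutation f \<longleftrightarrow> bij f \<and> bij (\<lambda>x. f x + x)"

definition mu3 :: "'a::field set" where
  "mu3 = {u. u \<noteq> 0 \<and> u ^ 3 = 1}"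

definition unit_kernel :: "nat \<Rightarrow> 'a::field set" where
  "unit_kernel s = {z. z \<noteq> 0 \<and> z ^ s = 1}"

definition cyclotomic_map :: "nat \<Rightarrow> nat \<Rightarrow> ('a \<Rightarrow> 'a) \<Rightarrow> 'a::field \<Rightarrow> 'a" where
  "cyclotomic_map r s c x = (if x = 0 then 0 else x ^ r * c (x ^ s))"

text \<open>The representative \<open>t\<close> of the fibre over \<open>u\<close> is an explicit argument, because \<open>\<beta>\<^sub>u\<close>
  depends on it.\<close>

definition beta :: "nat \<Rightarrow> ('a \<Rightarrow> 'a) \<Rightarrow> 'a \<Rightarrow> 'a \<Rightarrow> 'a::field" where
  "beta r c u t = c u * t ^ (r - 1)"

definition phi :: "nat \<Rightarrow> ('a \<Rightarrow> 'a) \<Rightarrow> 'a \<Rightarrow> 'a \<Rightarrow> 'a \<Rightarrow> 'a::field" where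
  "phi r c u t z = z * (1 + beta r c u t * z ^ (r - 1))"

definition vval :: "nat \<Rightarrow> nat \<Rightarrow> ('a \<Rightarrow> 'a) \<Rightarrow> 'a \<Rightarrow> 'a \<Rightarrow> 'a \<Rightarrow> 'a::field" where
  "vval r s c u t z = (1 + beta r c u t * z ^ (r - 1)) ^ s"

text \<open>The common value \<open>v(u)\<close>. If, for every \<open>t\<close> over \<open>u\<close>, \<open>vval r s c u t z\<close> does not depend on
  \<open>z\<close>, then it does not depend on \<open>t\<close> either, and the description below is proper
  (lemma \<open>common_v_eq\<close>).\<close>

definition common_v :: "nat \<Rightarrow> nat \<Rightarrow> ('a \<Rightarrow> 'a) \<Rightarrow> 'a \<Rightarrow> 'a::field" where
  "common_v r s c u = (THE w. \<exists>t z. t \<noteq> 0 \<and> t ^ s = u \<and> z \<in> unit_kernel s \<and> w = vval r s c u t z)"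

lemma vval_shift:
  "vval r s c u (t * y) z = vval r s c u t (y * z)"
  by (simp add: vval_def beta_def power_mult_distrib mult_ac)

lemma common_v_eq:
  fixes u :: "'a::field"
  assumes indep: "\<And>t z z'. t \<noteq> 0 \<Longrightarrow> t ^ s = u \<Longrightarrow> z \<in> unit_kernel s \<Longrightarrow> z' \<in> unit_kernel s
                    \<Longrightarrow> vval r s c u t z = vval r s c u t z'"
    and t: "t \<noteq> 0" "t ^ s = u" and z: "z \<in> unit_kernel s"
  shows "common_v r s c u = vval r s c u t z"
  unfolding common_v_def
proof (rule the_equality)
  show "\<exists>t' z'. t' \<noteq> 0 \<and> t' ^ s = u \<and> z' \<in> unit_kernel s \<and> vval r s c u t z = vval r s c u t' z'"
    using t z by blast
next
  fix w
  assume "\<exists>t' z'. t' \<noteq> 0 \<and> t' ^ s = u \<and> z' \<in> unit_kernel s \<and> w = vval r s c u t' z'"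
  then obtain t' z' where t': "t' \<noteq> 0" "t' ^ s = u" and z': "z' \<in> unit_kernel s"
    and w: "w = vval r s c u t' z'" by blast
  have "t ^ s \<noteq> 0" using t(1) by simp
  then have y: "(t' / t) ^ s = 1" using t(2) t'(2) by (simp add: power_divide)
  have "w = vval r s c u (t * (t' / t)) z'" using w t(1) by simp
  also have "\<dots> = vval r s c u t (t' / t * z')" by (rule vval_shift)
  also have "\<dots> = vval r s c u t z"
  proof (rule indep)
    show "t' / t * z' \<in> unit_kernel s"
      using y z' t(1) t'(1) unfolding unit_kernel_def
      by (simp add: power_mult_distrib del: times_divide_eq_left times_divide_eq_right)
  qed (use t z in auto)
  finally show "w = vval r s c u t z" .
qed

end

(* Both maps are instances of the AGW criterion for x \<mapsto> x^s: a map g with g(x)^s = P(x^s) on nonzero x,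
   where P is injective on mu3, is injective as soon as it is injective on each fibre of x \<mapsto> x^s.
   For f one has P(u) = u^r, and on a fibre x^r = y^r and x^s = y^s with gcd(r, s) = 1 force x = y.
   For F one has P(u) = u v(u), and F(t z) = t phi_u(z) parametrises the fibre through t by z in K. *)
theory Submission imports Defs begin

text \<open>Multiplication by \<open>x\<close> permutes the nonzero elements, so their product is
  unchanged when each factor is multiplied by \<open>x\<close>; cancelling this nonzero product
  leaves the power of \<open>x\<close>.\<close>

lemma finite_field_power_card_minus_1:
  fixes x :: "'a::{field,finite}"
  assumes "x \<noteq> 0"
  shows "x ^ (CARD('a) - 1) = 1"
proof -
  let ?U = "UNIV - {0::'a}"
  have "bij_betw ((*) x) ?U ?U"
    by (rule bij_betwI[where g = "\<lambda>y. y / x"]) (use assms in auto)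
  then have "\<Prod>?U = (\<Prod>y\<in>?U. x * y)"
    by (rule prod.reindex_bij_betw[symmetric])
  also have "\<dots> = x ^ (CARD('a) - 1) * \<Prod>?U"
    by (simp add: prod.distrib card_Diff_singleton)
  finally show ?thesis by simp
qed

lemma coprime_powers_eq_1:
  fixes x :: "'a::field"
  assumes "gcd m n = 1" "x ^ m = 1" "x ^ n = 1"
  shows "x = 1"
\<comment> \<open>Subtraction-free Bezout \<open>m * i = n * j + 1\<close> requires \<open>m\<close>
  nonzero; for \<open>m = 0\<close> the gcd condition forces \<open>n = 1\<close>.\<close>
proof (cases "m = 0")
  case False
  then obtain i j where "m * i = n * j + 1"
    using bezout_nat[of m n] assms(1) by auto
  then have "(x ^ m) ^ i = (x ^ n) ^ j * x"
    by (metis power_add power_mult power_one_right)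
  then show ?thesis using assms by simp
qed (use assms in simp)

lemma coprime_powers_inj:
  fixes x y :: "'a::field"
  assumes "gcd m n = 1" "x ^ m = y ^ m" "x ^ n = y ^ n" "y \<noteq> 0"
  shows "x = y"
  using coprime_powers_eq_1[of m n "x / y"] assms by (simp add: power_divide)

text \<open>Taking s-th powers of \<open>g x = g y\<close> and cancelling \<open>P\<close> puts
  nonzero \<open>x\<close> and \<open>y\<close> in one fibre, where \<open>fibre\<close> applies;
  finiteness then gives surjectivity. Zero stands apart, as it lies over no element of
  \<open>mu3\<close> in the applications.\<close>

lemma bij_if_fibrewise_inj:
  fixes g :: "'a::{field,finite} \<Rightarrow> 'a"
  assumes zero: "g 0 = 0" "\<And>x. x \<noteq> 0 \<Longrightarrow> g x \<noteq> 0"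
    and pow: "\<And>x. x \<noteq> 0 \<Longrightarrow> g x ^ s = P (x ^ s)"
    and mem: "\<And>x. x \<noteq> 0 \<Longrightarrow> x ^ s \<in> A"
    and P: "inj_on P A"
    and fibre: "\<And>x y. x \<noteq> 0 \<Longrightarrow> y \<noteq> 0 \<Longrightarrow> x ^ s = y ^ s \<Longrightarrow> g x = g y \<Longrightarrow> x = y"
  shows "bij g"
proof -
  have "inj g"
  proof (rule injI)
    fix x y assume eq: "g x = g y"
    show "x = y"
    proof (cases "x = 0 \<or> y = 0")
      case True
      then show ?thesis using zero eq by metis
    next
      case False
      then have "P (x ^ s) = P (y ^ s)" using pow eq by metis
      then have "x ^ s = y ^ s" using P mem False by (auto dest: inj_onD)
      then show ?thesis using fibre False eq by blast
    qed
  qed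
  then show ?thesis by (simp add: bij_def finite_UNIV_inj_surj)
qed

theorem theorem4p1:
  fixes c f :: "'a::{field,finite} \<Rightarrow> 'a" and q r s :: nat
  assumes q: "q = CARD('a)" and q_mod: "[q = 1] (mod 3)"
    and s: "s = (q - 1) div 3"
    and r: "r > 0"
    and c: "c \<in> mu3 \<rightarrow> UNIV - {0}"
    and f: "f = cyclotomic_map r s c"
    and G1: "gcd r s = 1" "gcd r 3 = 1" "\<And>u. u \<in> mu3 \<Longrightarrow> c u ^ s = 1"
    and G2: "\<And>u t. u \<in> mu3 \<Longrightarrow> t \<noteq> 0 \<Longrightarrow> t ^ s = u \<Longrightarrow>
               phi r c u t \<in> unit_kernel s \<rightarrow> UNIV - {0} \<and> inj_on (phi r c u t) (unit_kernel s)"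
    and G3: "\<And>u t. u \<in> mu3 \<Longrightarrow> t \<noteq> 0 \<Longrightarrow> t ^ s = u \<Longrightarrow>
               (\<forall>z\<in>unit_kernel s. \<forall>z'\<in>unit_kernel s. vval r s c u t z = vval r s c u t z') \<and>
               (\<forall>z\<in>unit_kernel s. vval r s c u t z \<in> mu3)"
    and G4: "bij_betw (\<lambda>u. u * common_v r s c u) mu3 mu3"
  shows "complete_permutation f"
proof -
  have q_s: "s * 3 = CARD('a) - 1"
  proof -
    \<comment> \<open>This makes the truncating division that defines \<open>s\<close>
      exact.\<close>
    have "3 dvd q - 1"
      using q_mod q by (metis cong_to_1_nat)
    then show ?thesis using s q by simp
  qed
  have mem: "x ^ s \<in> mu3" if "x \<noteq> 0" for x :: 'a
    using that finite_field_power_card_minus_1[OF that]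
    by (simp add: mu3_def q_s flip: power_mult)
  have f_nz: "f x = x ^ r * c (x ^ s)" if "x \<noteq> 0" for x
    using that by (simp add: f cyclotomic_map_def)
  have c_nz: "c (x ^ s) \<noteq> 0" if "x \<noteq> 0" for x
    using c mem[OF that] by blast
  have f0: "f 0 = 0"
    by (simp add: f cyclotomic_map_def)
  have "bij f"
  proof (rule bij_if_fibrewise_inj[where P = "\<lambda>u. u ^ r" and s = s and A = mu3])
    show "f 0 = 0" by (fact f0)
  next
    fix x :: 'a assume x: "x \<noteq> 0"
    show "f x \<noteq> 0" using x by (simp add: f_nz c_nz)
    \<comment> \<open>The factor \<open>c (x ^ s)\<close> disappears because its s-th power is
      1.\<close>
    show "f x ^ s = (x ^ s) ^ r"
      using x by (simp add: f_nz power_mult_distrib G1(3) mem mult.commute flip: power_mult)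
    show "x ^ s \<in> mu3" by (rule mem[OF x])
  next
    \<comment> \<open>Any two elements of \<open>mu3\<close> have equal cubes, so equal r-th powers
      suffice, \<open>r\<close> being coprime to 3.\<close>
    show "inj_on (\<lambda>u::'a. u ^ r) mu3"
      by (rule inj_onI) (auto simp: mu3_def intro: coprime_powers_inj[OF G1(2)])
  next
    fix x y :: 'a
    assume "x \<noteq> 0" "y \<noteq> 0" and s_eq: "x ^ s = y ^ s" and "f x = f y"
    \<comment> \<open>On one fibre the factor \<open>c (x ^ s)\<close> is common to both sides and
      nonzero, so it cancels.\<close>
    then have "x ^ r = y ^ r" using c_nz[of y] by (simp add: f_nz)
    then show "x = y" using coprime_powers_inj[OF G1(1)] s_eq \<open>y \<noteq> 0\<close> by blast
  qed
  moreover have "bij (\<lambda>x. f x + x)"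
  proof (rule bij_if_fibrewise_inj[where P = "\<lambda>u. u * common_v r s c u" and s = s and A = mu3])
    \<comment> \<open>Moving by \<open>z\<close> in the kernel keeps the s-th power, hence the value
      of \<open>c\<close>. Since \<open>r > 0\<close>, one factor \<open>t * z\<close> splits off
      the r-th power.\<close>
    have F_shift: "f (t * z) + t * z = t * phi r c (t ^ s) t z"
      if "t \<noteq> 0" "z \<in> unit_kernel s" for t z
    proof -
      have "(t * z) ^ r = t * z * (t ^ (r - 1) * z ^ (r - 1))"
        using r by (metis power_minus_mult power_mult_distrib mult.commute)
      moreover have "(t * z) ^ s = t ^ s"
        using that by (simp add: unit_kernel_def power_mult_distrib)
      ultimately show ?thesis
        using that by (simp add: f_nz unit_kernel_def phi_def beta_def algebra_simps)
    qed
    \<comment> \<open>The element 1 lets each \<open>x\<close> serve as the base point of its own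
      fibre.\<close>
    have one: "1 \<in> (unit_kernel s :: 'a set)" by (simp add: unit_kernel_def)
    have F_eq: "f x + x = x * phi r c (x ^ s) x 1" if "x \<noteq> 0" for x
      using F_shift[OF that one] by simp
    show "f 0 + 0 = 0" by (simp add: f0)
    show "f x + x \<noteq> 0" if "x \<noteq> 0" for x
      using G2[OF mem[OF that] that refl] one that by (auto simp: F_eq)
    show "(f x + x) ^ s = x ^ s * common_v r s c (x ^ s)" if x: "x \<noteq> 0" for x
    proof -
      have "common_v r s c (x ^ s) = vval r s c (x ^ s) x 1"
        by (rule common_v_eq) (use x one G3[OF mem[OF x]] in blast)+
      then show ?thesis
        using x by (simp add: F_eq phi_def vval_def power_mult_distrib)
    qed
    show "x ^ s \<in> mu3" if "x \<noteq> 0" for x :: 'a by (rule mem[OF that])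
    show "inj_on (\<lambda>u. u * common_v r s c u) mu3" using G4 by (rule bij_betw_imp_inj_on)
    show "x = y" if x: "x \<noteq> 0" "y \<noteq> 0" "x ^ s = y ^ s" and F: "f x + x = f y + y" for x y
    proof -
      \<comment> \<open>With \<open>x\<close> as base point, \<open>x\<close> and \<open>y\<close>
        have parameters 1 and \<open>z\<close>, so injectivity of \<open>phi\<close> on the kernel
        compares them.\<close>
      define z where "z = y / x"
      have z: "z \<in> unit_kernel s" and y: "y = x * z"
        using x by (simp_all add: z_def unit_kernel_def power_divide)
      have "phi r c (x ^ s) x 1 = phi r c (x ^ s) x z"
        using F F_eq[OF x(1)] F_shift[OF x(1) z] x(1) unfolding y by simp
      then have "1 = z"
        using G2[OF mem[OF x(1)] x(1) refl] one z by (auto dest: inj_onD)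
      then show "x = y" by (simp add: y)
    qed
  qed
  ultimately show ?thesis by (simp add: complete_permutation_def)
qed

end
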